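(* Let $p$ be an odd prime and let $k$ be a positive integer. Define \[ A=\sum_{0\le i\le(p-1)/2}(-1)^{\left(i+\frac{p-1}{2}\right)}\frac{p}{2i+1}\binom{i+\frac{p-1}{2}}{2i}k^{2i+1}. \] Then the polynomial $P(p,A)=x^{2p}-Ax^p+1$ is reducible. More precisely, \[ x^{2p}-Ax^p+1=(x^2-kx+1)\cdot Q(k,p), \] where $Q(k,p)$ is a palindromic polynomial in $x$ whose coefficients all lie in the set of values of the sequence $(a_i)_{i\ge1}$ defined by $a_1=0$, $a_2=1$, $a_{i+2}=ka_{i+1}-a_i$.
   Context: A polynomial is palindromic if its coefficient sequence reads the same forwards and backwards. Reducibility refers to factorization into nonconstant polynomials with integer (equivalently rational) coefficients. *)

theory Defs
  imports
    Complex_Main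
    "HOL-Computational_Algebra.Computational_Algebra"
begin

(* Rational-valued, since p / (2 i + 1) need not be an integer. *)
definition A_val :: "nat \<Rightarrow> int \<Rightarrow> rat" where
  "A_val p k =
     (\<Sum>i = 0..(p - 1) div 2.
        (- 1) ^ (i + (p - 1) div 2) * (of_nat p / of_nat (2 * i + 1)) *
        of_nat ((i + (p - 1) div 2) choose (2 * i)) * of_int k ^ (2 * i + 1))"

definition P_poly :: "nat \<Rightarrow> int \<Rightarrow> int poly" where
  "P_poly p A = monom 1 (2 * p) - monom A p + 1"

(* Not the negation of the library's irreducible: over the integers that
   would also count constant non-unit factors. *)
definition reducible_poly :: "int poly \<Rightarrow> bool" where
  "reducible_poly f \<longleftrightarrow> (\<exists>g h. degree g > 0 \<and> degree h > 0 \<and> f = g * h)"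

definition palindromic :: "'a::zero poly \<Rightarrow> bool" where
  "palindromic f \<longleftrightarrow> rev (coeffs f) = coeffs f"

(* Indexed from 1; the value at 0 is a dummy and is never used. *)
fun a_seq :: "int \<Rightarrow> nat \<Rightarrow> int" where
  "a_seq k 0 = 0"
| "a_seq k (Suc 0) = 0"
| "a_seq k (Suc (Suc 0)) = 1"
| "a_seq k (Suc (Suc (Suc i))) = k * a_seq k (Suc (Suc i)) - a_seq k (Suc i)"

end

theory Submission
  imports Defs
begin

(* If x + 1/x = k, then A_val p k is the Lucas-type value x^p + x^(-p), that is,
   the difference of the terms p + 2 and p of a_seq.  Hence x^2 - k x + 1 divides
   x^(2p) - A x^p + 1.  The quotient starts like the power series
   1 / (1 - k x + x^2), whose coefficients are the a_i, up to the middle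
   coefficient, and is continued by symmetry. *)

lemma a_seq_rec: "a_seq k (n + 3) = k * a_seq k (n + 2) - a_seq k (n + 1)"
  by (simp add: eval_nat_numeral)

text \<open>These are the Chebyshev polynomials U_n(k/2), expanded in ascending powers of
  \<open>k\<close>. The two parities feed each other, so they share one induction, and each step is
  Pascal's rule applied term by term. The free bound \<open>N\<close> keeps the summation range
  fixed; the surplus binomials are zero.\<close>

lemma a_seq_binomial_sums:
  assumes "m \<le> N"
  shows "a_seq k (2 * m + 1) =
           (\<Sum>i\<le>N. (- 1) ^ (m + i + 1) * int ((m + i) choose (2 * i + 1)) * k ^ (2 * i + 1)) \<and>
         a_seq k (2 * m + 2) =
           (\<Sum>i\<le>N. (- 1) ^ (m + i) * int ((m + i) choose (2 * i)) * k ^ (2 * i))"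
  using assms
proof (induction m)
  case 0
  have "(\<Sum>i\<le>N. (- 1) ^ i * int (i choose (2 * i)) * k ^ (2 * i)) =
        (\<Sum>i\<le>N. if i = 0 then 1 else 0)"
    by (intro sum.cong) (auto simp: binomial_eq_0)
  then show ?case
    by (simp add: binomial_eq_0 eval_nat_numeral)
next
  case (Suc m)
  define E where "E m i = (- 1) ^ (m + i + 1) * int ((m + i) choose (2 * i + 1)) * k ^ (2 * i + 1)"
    for m i
  define F where "F m i = (- 1) ^ (m + i) * int ((m + i) choose (2 * i)) * k ^ (2 * i)"
    for m i
  have IH: "a_seq k (2 * m + 1) = sum (E m) {..N}" "a_seq k (2 * m + 2) = sum (F m) {..N}"
    using Suc by (simp_all add: E_def F_def)
  have E_step: "E (Suc m) i = k * F m i - E m i" for i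
    by (simp add: E_def F_def algebra_simps)
  have "a_seq k (2 * Suc m + 1) = k * sum (F m) {..N} - sum (E m) {..N}"
    using a_seq_rec[of k "2 * m"] IH by (simp add: eval_nat_numeral)
  also have "\<dots> = sum (E (Suc m)) {..N}"
    by (simp add: E_step sum_subtractf sum_distrib_left)
  finally have E_Suc: "a_seq k (2 * Suc m + 1) = sum (E (Suc m)) {..N}" .
  obtain M where N: "N = Suc M"
    using Suc.prems by (cases N) auto
  have F_0: "F (Suc m) 0 = - F m 0"
    by (simp add: F_def)
  have F_step: "F (Suc m) (Suc i) = k * E (Suc m) i - F m (Suc i)" for i
    by (simp add: E_def F_def algebra_simps)
  \<comment> \<open>\<open>F_step\<close> pairs term i of \<open>E\<close> with term i + 1 of
    \<open>F\<close>, so the top term of \<open>E\<close> has no partner and must vanish.\<close>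
  have "E (Suc m) N = 0"
    using Suc.prems by (simp add: E_def binomial_eq_0)
  then have "k * sum (E (Suc m)) {..N} = (\<Sum>i\<le>M. k * E (Suc m) i)"
    by (simp add: N sum_distrib_left)
  then have "k * sum (E (Suc m)) {..N} - sum (F m) {..N} = sum (F (Suc m)) {..N}"
    by (simp add: N sum.atMost_Suc_shift F_0 F_step sum_subtractf del: sum.atMost_Suc)
  moreover have "a_seq k (2 * Suc m + 2) =
      k * a_seq k (2 * Suc m + 1) - a_seq k (2 * m + 2)"
    using a_seq_rec[of k "2 * m + 1"] by (simp add: eval_nat_numeral)
  ultimately have "a_seq k (2 * Suc m + 2) = sum (F (Suc m)) {..N}"
    using E_Suc IH by simp
  with E_Suc show ?case
    unfolding E_def F_def by (rule conjI)
qed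

text \<open>Multiply by 2i + 1: absorption turns the last binomial into m - i copies of C(m+i, 2i),
  Pascal's rule turns the other into (2i + 1) + (m - i) copies, and these add up to 2m + 1. Thus the
  fractions in \<open>A_val\<close> combine with the binomials to integers.\<close>

lemma choose_add_choose_Suc:
  assumes "i \<le> m"
  shows "of_nat (2 * m + 1) / of_nat (2 * i + 1) * of_nat ((m + i) choose (2 * i)) =
    (of_nat ((m + i + 1) choose (2 * i + 1)) + of_nat ((m + i) choose (2 * i + 1)) :: 'a::field_char_0)"
proof -
  have "(2 * i + 1) * ((m + i) choose (2 * i + 1)) = (m - i) * ((m + i) choose (2 * i))"
    using binomial_absorb_comp[of "m + i" "2 * i"] binomial_absorption[of "2 * i" "m + i"] assms
    by simp
  moreover have "(m - i) * ((m + i) choose (2 * i)) + (2 * i + 1) * ((m + i) choose (2 * i)) +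
      (m - i) * ((m + i) choose (2 * i)) = (2 * m + 1) * ((m + i) choose (2 * i))"
  proof -
    have "(m - i) + (2 * i + 1) + (m - i) = 2 * m + 1"
      using assms by simp
    then show ?thesis
      by (simp only: flip: distrib_right)
  qed
  ultimately have "(2 * i + 1) * (((m + i + 1) choose (2 * i + 1)) + ((m + i) choose (2 * i + 1))) =
      (2 * m + 1) * ((m + i) choose (2 * i))"
    by (simp add: distrib_left del: mult_Suc)
  then have "of_nat (2 * i + 1) * (of_nat ((m + i + 1) choose (2 * i + 1)) +
      of_nat ((m + i) choose (2 * i + 1)) :: 'a) = of_nat (2 * m + 1) * of_nat ((m + i) choose (2 * i))"
    by (metis of_nat_add of_nat_mult)
  moreover have "(of_nat (2 * i + 1) :: 'a) \<noteq> 0"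
    by (metis Suc_eq_plus1 of_nat_neq_0)
  ultimately show ?thesis
    by (simp only: times_divide_eq_left divide_eq_eq mult.commute[of _ "of_nat (2 * i + 1)"]
        not_False_eq_True if_True)
qed

text \<open>In the sums for the terms 2m + 3 and 2m + 1 the signs are opposite, so their difference
  adds the two binomials of \<open>choose_add_choose_Suc\<close>.\<close>

lemma A_val_eq_a_seq:
  assumes "odd p"
  shows "A_val p k = of_int (a_seq k (p + 2) - a_seq k p)"
proof -
  obtain m where p: "p = 2 * m + 1"
    using assms oddE by blast
  have "a_seq k (p + 2) - a_seq k p =
    (\<Sum>i\<le>m. (- 1) ^ (i + m) *
       (int ((m + i + 1) choose (2 * i + 1)) + int ((m + i) choose (2 * i + 1))) * k ^ (2 * i + 1))"
  proof -
    have "a_seq k (p + 2) = (\<Sum>i\<le>Suc m. (- 1) ^ (Suc m + i + 1) *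
        int ((Suc m + i) choose (2 * i + 1)) * k ^ (2 * i + 1))"
      using a_seq_binomial_sums[of "Suc m" "Suc m" k] p by (simp add: eval_nat_numeral)
    \<comment> \<open>The term i = m + 1 contains C(2m+2, 2m+3) = 0.\<close>
    also have "\<dots> = (\<Sum>i\<le>m. (- 1) ^ (Suc m + i + 1) *
        int ((Suc m + i) choose (2 * i + 1)) * k ^ (2 * i + 1))"
      by (simp add: binomial_eq_0)
    finally show ?thesis
      using a_seq_binomial_sums[of m m k] p
      by (simp add: sum_subtractf[symmetric] algebra_simps)
  qed
  then have "of_int (a_seq k (p + 2) - a_seq k p) =
    (\<Sum>i\<le>m. (- 1) ^ (i + m) *
       (of_nat ((m + i + 1) choose (2 * i + 1)) + of_nat ((m + i) choose (2 * i + 1))) *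
       (of_int k :: rat) ^ (2 * i + 1))"
    by (simp only: of_int_sum of_int_mult of_int_power of_int_add of_int_minus of_int_1
        of_int_of_nat_eq)
  also have "\<dots> = A_val p k"
  proof -
    have "(p - 1) div 2 = m"
      using p by simp
    moreover have "(- 1) ^ (i + m) * (of_nat p / of_nat (2 * i + 1)) * of_nat ((i + m) choose (2 * i)) *
          of_int k ^ (2 * i + 1) =
        (- 1) ^ (i + m) *
          (of_nat ((m + i + 1) choose (2 * i + 1)) + of_nat ((m + i) choose (2 * i + 1))) *
          (of_int k :: rat) ^ (2 * i + 1)" if "i \<le> m" for i
      using choose_add_choose_Suc[OF that, symmetric, where 'a = rat]
      by (simp only: p add.commute[of i m] mult.assoc)
    ultimately show ?thesis
      unfolding A_val_def by (intro sum.cong) auto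
  qed
  finally show ?thesis ..
qed

(* At index 2 p - 1 and beyond, the truncated subtraction makes this 0, as it
   should be for the coefficients of a polynomial of degree 2 p - 2. *)
definition quot_coeff :: "int \<Rightarrow> nat \<Rightarrow> nat \<Rightarrow> int" where
  "quot_coeff k p j = a_seq k (min (j + 2) (2 * p - j))"

definition quot_poly :: "int \<Rightarrow> nat \<Rightarrow> int poly" where
  "quot_poly k p = Poly (map (quot_coeff k p) [0..<2 * p - 1])"

lemma coeff_quot_poly: "coeff (quot_poly k p) j = quot_coeff k p j"
proof (cases "j < 2 * p - 1")
  case False
  \<comment> \<open>\<open>a_seq\<close> is 0 at both indices, which agrees with the default 0 of
    \<open>nth_default\<close>.\<close>
  then have "2 * p - j = 0 \<or> 2 * p - j = 1"
    by linarith
  then show ?thesis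
    using False by (auto simp: quot_poly_def quot_coeff_def nth_default_def)
qed (simp add: quot_poly_def nth_default_def)

text \<open>\<open>Poly\<close> strips trailing zeros, but the last entry is a_2 = 1, so the list
  survives intact.\<close>

lemma coeffs_quot_poly:
  assumes "p > 0"
  shows "coeffs (quot_poly k p) = map (quot_coeff k p) [0..<2 * p - 1]"
proof -
  have "[0..<2 * p - 1] = [0..<2 * p - 2] @ [2 * p - 2]"
    using assms upt_Suc_append[of 0 "2 * p - 2"] by (simp add: Suc_diff_Suc numeral_2_eq_2)
  moreover have "quot_coeff k p (2 * p - 2) = 1"
    using assms by (simp add: quot_coeff_def eval_nat_numeral Suc_diff_Suc)
  ultimately show ?thesis
    by (simp add: quot_poly_def)
qed

lemma degree_quot_poly:
  assumes "p > 0"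
  shows "degree (quot_poly k p) = 2 * p - 2"
  using assms by (simp add: degree_eq_length_coeffs coeffs_quot_poly)

text \<open>The reflection of j to 2p - 2 - j swaps the two arguments of \<open>min\<close>.\<close>

lemma palindromic_quot_poly:
  assumes "p > 0"
  shows "palindromic (quot_poly k p)"
  unfolding palindromic_def coeffs_quot_poly[OF assms]
proof (rule nth_equalityI)
  fix j assume "j < length (rev (map (quot_coeff k p) [0..<2 * p - 1]))"
  then have j: "j < 2 * p - 1" by simp
  then have "min (2 * p - 1 - Suc j + 2) (2 * p - (2 * p - 1 - Suc j)) = min (j + 2) (2 * p - j)"
    by linarith
  with j show "rev (map (quot_coeff k p) [0..<2 * p - 1]) ! j =
      map (quot_coeff k p) [0..<2 * p - 1] ! j"
    by (simp add: rev_nth quot_coeff_def)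
qed simp

lemma set_coeffs_quot_poly:
  assumes "p > 0"
  shows "set (coeffs (quot_poly k p)) \<subseteq> a_seq k ` {1..}"
  unfolding coeffs_quot_poly[OF assms] by (auto simp: quot_coeff_def)

text \<open>The left side is the coefficient of degree n + 2 in the product with x^2 - k x + 1. Away
  from the peak a_(p+1) and the upper end it is the recurrence. At the peak it is a_p - k a_(p+1) +
  a_p = a_p - a_(p+2).\<close>

lemma quot_coeff_rec:
  assumes "p > 0"
  shows "quot_coeff k p (n + 2) - k * quot_coeff k p (n + 1) + quot_coeff k p n =
    (if n + 2 = 2 * p then 1 else if n + 2 = p then a_seq k p - a_seq k (p + 2) else 0)"
proof -
  consider "n + 2 < p" | "n + 2 = p" | "p < n + 2" "n + 2 < 2 * p" | "n + 2 = 2 * p"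
    | "n + 2 = 2 * p + 1" | "2 * p + 1 < n + 2"
    by linarith
  then show ?thesis
  proof cases
    case 1
    then show ?thesis
      using a_seq_rec[of k "n + 1"] by (simp add: quot_coeff_def min_def eval_nat_numeral)
  next
    case 2
    then show ?thesis
      using a_seq_rec[of k "n + 1"] by (auto simp: quot_coeff_def min_def eval_nat_numeral)
  next
    case 3
    \<comment> \<open>Past the peak the indices descend; the recurrence is symmetric, so it also
      holds read backwards.\<close>
    define d where "d = 2 * p - n - 3"
    from 3 have "quot_coeff k p (n + 2) = a_seq k (d + 1)"
      "quot_coeff k p (n + 1) = a_seq k (d + 2)" "quot_coeff k p n = a_seq k (d + 3)"
      unfolding quot_coeff_def d_def by (auto intro!: arg_cong[of _ _ "a_seq k"])
    with 3 show ?thesis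
      using a_seq_rec[of k d] by simp
  next
    case 4
    then have "2 * p - n = 2" "2 * p - (n + 1) = 1" "2 * p - (n + 2) = 0"
      by linarith+
    then show ?thesis
      using 4 by (simp add: quot_coeff_def eval_nat_numeral)
  next
    case 5
    then have "2 * p - n = 1" "2 * p - (n + 1) = 0" "2 * p - (n + 2) = 0"
      by linarith+
    then show ?thesis
      using 5 assms by (simp add: quot_coeff_def)
  next
    case 6
    then show ?thesis by (simp add: quot_coeff_def)
  qed
qed

lemma P_poly_factorization:
  assumes "p > 0"
  shows "P_poly p (a_seq k (p + 2) - a_seq k p) = [:1, - k, 1:] * quot_poly k p"
proof (rule poly_eqI)
  fix n :: nat
  have q0: "quot_coeff k p 0 = 1"
    using assms by (simp add: quot_coeff_def min_def eval_nat_numeral)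
  consider "n = 0" | "n = 1" | m where "n = m + 2"
    by (metis One_nat_def add_2_eq_Suc' not0_implies_Suc)
  then show "coeff (P_poly p (a_seq k (p + 2) - a_seq k p)) n =
      coeff ([:1, - k, 1:] * quot_poly k p) n"
  proof cases
    case 1
    then show ?thesis
      using assms q0 by (simp add: P_poly_def coeff_quot_poly)
  next
    case 2
    \<comment> \<open>For p = 1 the quotient is the constant 1, and the middle term of
      \<open>P_poly\<close> has degree 1.\<close>
    have "quot_coeff k p 1 = (if p = 1 then 0 else k)"
      using assms by (auto simp: quot_coeff_def min_def eval_nat_numeral)
    then show ?thesis
      using 2 assms q0
      by (auto simp: P_poly_def coeff_quot_poly eval_nat_numeral)
  next
    case 3
    then have "coeff ([:1, - k, 1:] * quot_poly k p) n =
        quot_coeff k p (m + 2) - k * quot_coeff k p (m + 1) + quot_coeff k p m"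
      by (simp add: coeff_quot_poly)
    also have "\<dots> = coeff (P_poly p (a_seq k (p + 2) - a_seq k p)) n"
      using 3 assms unfolding quot_coeff_rec[OF assms] by (auto simp: P_poly_def)
    finally show ?thesis ..
  qed
qed

theorem theorem1:
  fixes p :: nat and k :: int
  assumes "prime p" and "odd p" and "k > 0"
  shows "\<exists>A :: int. of_int A = A_val p k \<and>
           reducible_poly (P_poly p A) \<and>
           (\<exists>Q :: int poly. P_poly p A = [:1, - k, 1:] * Q \<and>
              palindromic Q \<and> set (coeffs Q) \<subseteq> a_seq k ` {1..})"
proof -
  have p: "p > 1"
    using assms(1) by (rule prime_gt_1_nat)
  define A where "A = a_seq k (p + 2) - a_seq k p"
  have fact: "P_poly p A = [:1, - k, 1:] * quot_poly k p"
    using p by (simp only: A_def P_poly_factorization)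
  have "of_int A = A_val p k"
    using A_val_eq_a_seq[OF assms(2)] by (simp add: A_def)
  \<comment> \<open>The factors have degrees 2 and 2p - 2, both positive since p > 1.\<close>
  moreover have "reducible_poly (P_poly p A)"
    unfolding reducible_poly_def
    using p fact degree_quot_poly[of p k]
    by (intro exI[of _ "[:1, - k, 1:]"] exI[of _ "quot_poly k p"]) simp
  ultimately show ?thesis
    using fact p palindromic_quot_poly set_coeffs_quot_poly by (metis gr_implies_not0 gr0I)
qed

end
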